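(* Let $R$ be a characteristic range set and let $Y$ be an ultrametrizable space such that $\mathrm{UComp}(Y;R)\neq\emptyset$. If $\mathrm{UComp}(Y;R)$ is a Borel subset of $\mathrm{UCPM}(Y;R)$, then $Y$ is separable. Likewise, if $\mathrm{UComp}(Y;R)$ (with the subspace topology) is completely metrizable, then $Y$ is separable.
   Context: A topological space is ultrametrizable if its topology is induced by some ultrametric. A range set is a set $R\subseteq[0,\infty)$ with $0\in R$; it is characteristic if for every $t>0$ there exists $r\in R\setminus\{0\}$ with $r\le t$. Write $a\lor b=\max\{a,b\}$. For a topological space $X$, an $R$-valued continuous pseudo-ultrametric on $X$ is a continuous map $d\colon X\times X\to[0,\infty)$ with $d(x,x)=0$, $d(x,y)=d(y,x)$, $d(x,z)\le d(x,y)\lor d(y,z)$ for all $x,y,z\in X$, and $d(X^2)\subseteq R$. $\mathrm{UCPM}(X;R)$ is the set of all of these, equipped with the topology induced by the ($[0,\infty]$-valued) metric $\mathcal{UD}_X^R(d,e)=\inf\{\varepsilon\in R\cup\{\infty\} : d(x,y)\le e(x,y)\lor\varepsilon \text{ and } e(x,y)\le d(x,y)\lor\varepsilon \text{ for all } x,y\in X\}$. $\mathrm{UMet}(X;R)\subseteq\mathrm{UCPM}(X;R)$ is the set of all $R$-valued ultrametrics on $X$ that induce the topology of $X$, and $\mathrm{UComp}(X;R)\subseteq\mathrm{UMet}(X;R)$ is the set of those that are complete. *)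

theory Defs
  imports "HOL-Analysis.Analysis"
begin

definition range_set :: "real set \<Rightarrow> bool"
  where "range_set R \<longleftrightarrow> R \<subseteq> {0..} \<and> 0 \<in> R"

definition characteristic :: "real set \<Rightarrow> bool"
  where "characteristic R \<longleftrightarrow> (\<forall>t>0. \<exists>r\<in>R - {0}. r \<le> t)"

definition ultrametric_on :: "'a set \<Rightarrow> ('a \<Rightarrow> 'a \<Rightarrow> real) \<Rightarrow> bool"
  where "ultrametric_on M d \<longleftrightarrow>
    Metric_space M d \<and> (\<forall>x\<in>M. \<forall>y\<in>M. \<forall>z\<in>M. d x z \<le> max (d x y) (d y z))"

definition ultrametrizable_space :: "'a topology \<Rightarrow> bool"
  where "ultrametrizable_space X \<longleftrightarrow>
    (\<exists>d. ultrametric_on (topspace X) d \<and> Metric_space.mtopology (topspace X) d = X)"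

text \<open>
  A map on the square of the carrier is represented by its extension by zero to the whole type.
  This makes the representation unique.  The value zero is forced by the library locale for
  metric spaces, which requires nonnegativity and symmetry outside the carrier as well.
\<close>

definition zero_outside :: "'a set \<Rightarrow> ('a \<Rightarrow> 'a \<Rightarrow> real) \<Rightarrow> bool"
  where "zero_outside M d \<longleftrightarrow> (\<forall>x y. x \<notin> M \<or> y \<notin> M \<longrightarrow> d x y = 0)"

definition UCPM :: "'a topology \<Rightarrow> real set \<Rightarrow> ('a \<Rightarrow> 'a \<Rightarrow> real) set"
  where "UCPM X R = {d. zero_outside (topspace X) d \<and>
    continuous_map (prod_topology X X) (top_of_set {0..}) (\<lambda>(x, y). d x y) \<and>
    (\<forall>x\<in>topspace X. d x x = 0) \<and>
    (\<forall>x\<in>topspace X. \<forall>y\<in>topspace X. d x y = d y x) \<and>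
    (\<forall>x\<in>topspace X. \<forall>y\<in>topspace X. \<forall>z\<in>topspace X. d x z \<le> max (d x y) (d y z)) \<and>
    (\<forall>x\<in>topspace X. \<forall>y\<in>topspace X. d x y \<in> R)}"

definition UMet :: "'a topology \<Rightarrow> real set \<Rightarrow> ('a \<Rightarrow> 'a \<Rightarrow> real) set"
  where "UMet X R = {d. zero_outside (topspace X) d \<and> ultrametric_on (topspace X) d \<and>
    (\<forall>x\<in>topspace X. \<forall>y\<in>topspace X. d x y \<in> R) \<and>
    Metric_space.mtopology (topspace X) d = X}"

definition UComp :: "'a topology \<Rightarrow> real set \<Rightarrow> ('a \<Rightarrow> 'a \<Rightarrow> real) set"
  where "UComp X R = {d \<in> UMet X R. Metric_space.mcomplete (topspace X) d}"

definition UD :: "'a topology \<Rightarrow> real set \<Rightarrow> ('a \<Rightarrow> 'a \<Rightarrow> real) \<Rightarrow> ('a \<Rightarrow> 'a \<Rightarrow> real) \<Rightarrow> ennreal"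
  where "UD X R d e = Inf {\<epsilon> \<in> ennreal ` R \<union> {\<infinity>}. \<forall>x\<in>topspace X. \<forall>y\<in>topspace X.
    ennreal (d x y) \<le> max (ennreal (e x y)) \<epsilon> \<and> ennreal (e x y) \<le> max (ennreal (d x y)) \<epsilon>}"

definition UCPM_topology :: "'a topology \<Rightarrow> real set \<Rightarrow> ('a \<Rightarrow> 'a \<Rightarrow> real) topology"
  where "UCPM_topology X R = topology (\<lambda>U. U \<subseteq> UCPM X R \<and>
    (\<forall>d\<in>U. \<exists>\<epsilon>>0. {e \<in> UCPM X R. UD X R d e < \<epsilon>} \<subseteq> U))"

definition borel_in :: "'a topology \<Rightarrow> 'a set \<Rightarrow> bool"
  where "borel_in X S \<longleftrightarrow> S \<in> sigma_sets (topspace X) {U. openin X U}"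

lemma openin_UCPM_topology:
  "openin (UCPM_topology X R) U \<longleftrightarrow>
    U \<subseteq> UCPM X R \<and> (\<forall>d\<in>U. \<exists>\<epsilon>>0. {e \<in> UCPM X R. UD X R d e < \<epsilon>} \<subseteq> U)"
proof -
  let ?P = "\<lambda>U. U \<subseteq> UCPM X R \<and> (\<forall>d\<in>U. \<exists>\<epsilon>>0. {e \<in> UCPM X R. UD X R d e < \<epsilon>} \<subseteq> U)"
  have "istopology ?P"
    unfolding istopology_def
  proof (intro conjI allI impI)
    fix S T
    assume S: "?P S" and T: "?P T"
    show "S \<inter> T \<subseteq> UCPM X R"
      using S by blast
    show "\<forall>d\<in>S \<inter> T. \<exists>\<epsilon>>0. {e \<in> UCPM X R. UD X R d e < \<epsilon>} \<subseteq> S \<inter> T"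
    proof
      fix d
      assume "d \<in> S \<inter> T"
      then obtain a b where "a > 0" "{e \<in> UCPM X R. UD X R d e < a} \<subseteq> S"
        "b > 0" "{e \<in> UCPM X R. UD X R d e < b} \<subseteq> T"
        using S T by blast
      then show "\<exists>\<epsilon>>0. {e \<in> UCPM X R. UD X R d e < \<epsilon>} \<subseteq> S \<inter> T"
        by (intro exI[of _ "min a b"]) auto
    qed
  next
    fix K
    assume K: "\<forall>S\<in>K. ?P S"
    then show "\<Union>K \<subseteq> UCPM X R"
      by blast
    show "\<forall>d\<in>\<Union>K. \<exists>\<epsilon>>0. {e \<in> UCPM X R. UD X R d e < \<epsilon>} \<subseteq> \<Union>K"
      using K by (meson UnionE Union_upper subset_trans)
  qed
  then show ?thesis
    by (simp add: UCPM_topology_def)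
qed

lemma topspace_UCPM_topology: "topspace (UCPM_topology X R) = UCPM X R"
proof -
  have "openin (UCPM_topology X R) (UCPM X R)"
    by (auto simp: openin_UCPM_topology intro!: exI[of _ 1])
  then show ?thesis
    by (meson openin_UCPM_topology openin_subset openin_topspace subset_antisym)
qed

lemma UMet_subset_UCPM: "UMet X R \<subseteq> UCPM X R"
proof
  fix d
  assume d: "d \<in> UMet X R"
  then interpret Metric_space "topspace X" d
    by (simp add: UMet_def ultrametric_on_def)
  have top: "mtopology = X"
    using d by (simp add: UMet_def)
  have "continuous_map (prod_topology X X) euclidean
      (\<lambda>p. mdist (metric (topspace X, d)) (fst p) (snd p))"
    using top
    by (intro continuous_map_mdist) (auto simp: mtopology_of_def continuous_map_fst continuous_map_snd)
  then have "continuous_map (prod_topology X X) euclidean (\<lambda>(x, y). d x y)"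
    by (simp add: case_prod_unfold)
  then show "d \<in> UCPM X R"
    using d by (auto simp: UCPM_def UMet_def ultrametric_on_def continuous_map_in_subtopology commute)
qed

lemma UComp_subset_UMet: "UComp X R \<subseteq> UMet X R"
  by (auto simp: UComp_def)

end

theory Submission
  imports Defs
begin

text \<open>
  A complete \<open>R\<close>-valued ultrametric \<open>d\<close> on a non-separable space is not totally bounded, so the
  space splits into infinitely many balls of some fixed radius.  Group them into clopen pieces
  indexed by finite sequences of naturals, and let \<open>r\<close> be a sequence in \<open>R\<close> decreasing to \<open>0\<close>.
  For a tree \<open>T\<close>, cap \<open>d\<close> at \<open>r (length s)\<close> inside the piece with index \<open>s\<close>, and put two pieces at
  distance \<open>r n\<close>, where \<open>n\<close> is the length of the longest common prefix of their indices in \<open>T\<close>.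
  This ultrametric always induces the given topology, and it is complete if and only if \<open>T\<close> has
  no infinite branch.  It depends continuously on \<open>T\<close>, even for the uniform topology, so Borelness
  of the set of complete ultrametrics would make well-foundedness of trees an analytic property,
  which the diagonal argument refutes.  Complete metrizability reduces to the Borel case, because
  a completely metrizable subspace of a metrizable space is \<open>G\<^sub>\<delta>\<close>.
\<close>

section \<open>Analytic sets of binary sequences\<close>

definition agree :: "nat \<Rightarrow> (nat \<Rightarrow> 'b) \<Rightarrow> (nat \<Rightarrow> 'b) \<Rightarrow> bool"
  where "agree n x y \<longleftrightarrow> (\<forall>i<n. x i = y i)"

lemma agree_iff_map: "agree n x y \<longleftrightarrow> map x [0..<n] = map y [0..<n]"
  by (auto simp: agree_def)

text \<open>Closed subsets of the product of Cantor space and Baire space: basic neighbourhoods fix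
  an initial segment of both coordinates.\<close>

definition closed_rel :: "((nat \<Rightarrow> bool) \<Rightarrow> (nat \<Rightarrow> nat) \<Rightarrow> bool) \<Rightarrow> bool"
  where "closed_rel C \<longleftrightarrow>
    (\<forall>x y. \<not> C x y \<longrightarrow> (\<exists>n. \<forall>x' y'. agree n x x' \<longrightarrow> agree n y y' \<longrightarrow> \<not> C x' y'))"

text \<open>Projections of closed sets along Baire space. In this form, closure properties come from
  recoding the witness \<open>y\<close>.\<close>

definition analytic :: "(nat \<Rightarrow> bool) set \<Rightarrow> bool"
  where "analytic A \<longleftrightarrow> (\<exists>C. closed_rel C \<and> A = {x. \<exists>y. C x y})"

definition open_seq :: "(nat \<Rightarrow> bool) set \<Rightarrow> bool"
  where "open_seq V \<longleftrightarrow> (\<forall>x\<in>V. \<exists>n. \<forall>x'. agree n x x' \<longrightarrow> x' \<in> V)"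

text \<open>The first term of the witness states how long an initial segment of \<open>x\<close>
  forces membership in \<open>V\<close>.\<close>

lemma analytic_open_seq:
  assumes "open_seq V"
  shows "analytic V"
proof -
  define C where "C = (\<lambda>x (y :: nat \<Rightarrow> nat). \<forall>x'. agree (y 0) x x' \<longrightarrow> x' \<in> V)"
  have "closed_rel C"
    unfolding closed_rel_def
  proof (intro allI impI)
    fix x y
    assume "\<not> C x y"
    then obtain z where z: "agree (y 0) x z" "z \<notin> V"
      by (auto simp: C_def)
    \<comment> \<open>Length \<open>Suc (y 0)\<close> fixes the entry \<open>y' 0\<close> itself as
      well as the first \<open>y 0\<close> terms of \<open>x'\<close>.\<close>
    have "\<not> C x' y'" if "agree (Suc (y 0)) x x'" "agree (Suc (y 0)) y y'" for x' y'
    proof -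
      have "agree (y' 0) x' z"
        using that z(1) by (simp add: agree_def)
      then show ?thesis
        using z(2) by (auto simp: C_def)
    qed
    then show "\<exists>n. \<forall>x' y'. agree n x x' \<longrightarrow> agree n y y' \<longrightarrow> \<not> C x' y'"
      by blast
  qed
  moreover have "V = {x. \<exists>y. C x y}"
  proof (intro equalityI subsetI CollectI)
    fix x
    assume "x \<in> V"
    then obtain n where "\<forall>x'. agree n x x' \<longrightarrow> x' \<in> V"
      using assms by (auto simp: open_seq_def)
    then have "C x (\<lambda>_. n)"
      by (simp add: C_def)
    then show "\<exists>y. C x y"
      by blast
  next
    fix x
    assume "x \<in> {x. \<exists>y. C x y}"
    then show "x \<in> V"
      by (auto simp: C_def agree_def)
  qed
  ultimately show ?thesis
    by (auto simp: analytic_def)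
qed

lemma analytic_Compl_open_seq:
  assumes "open_seq V"
  shows "analytic (- V)"
proof -
  have "closed_rel (\<lambda>x y. x \<notin> V)"
    using assms unfolding closed_rel_def open_seq_def by blast
  then show ?thesis
    unfolding analytic_def by (intro exI[of _ "\<lambda>x y. x \<notin> V"]) auto
qed

text \<open>The first term of a witness selects the index \<open>i\<close>; the remaining terms
  witness membership in \<open>A i\<close>.\<close>

lemma analytic_UN:
  fixes A :: "nat \<Rightarrow> (nat \<Rightarrow> bool) set"
  assumes "\<And>i. analytic (A i)"
  shows "analytic (\<Union>i. A i)"
proof -
  obtain C where C: "\<And>i. closed_rel (C i)" "\<And>i. A i = {x. \<exists>y. C i x y}"
    using assms unfolding analytic_def by metis
  define D where "D = (\<lambda>x y. C (y 0) x (\<lambda>j. y (Suc j)))"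
  have "closed_rel D"
    unfolding closed_rel_def
  proof (intro allI impI)
    fix x y
    assume "\<not> D x y"
    then obtain n where n: "\<And>x' y'. agree n x x' \<Longrightarrow> agree n (\<lambda>j. y (Suc j)) y' \<Longrightarrow> \<not> C (y 0) x' y'"
      using C(1) unfolding closed_rel_def D_def by metis
    have "\<not> D x' y'" if "agree (Suc n) x x'" "agree (Suc n) y y'" for x' y'
    proof -
      have "y' 0 = y 0" "agree n x x'" "agree n (\<lambda>j. y (Suc j)) (\<lambda>j. y' (Suc j))"
        using that by (auto simp: agree_def)
      then show ?thesis
        using n by (simp add: D_def)
    qed
    then show "\<exists>n. \<forall>x' y'. agree n x x' \<longrightarrow> agree n y y' \<longrightarrow> \<not> D x' y'"
      by blast
  qed
  moreover have "(\<Union>i. A i) = {x. \<exists>y. D x y}"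
  proof (intro equalityI subsetI CollectI)
    fix x
    assume "x \<in> (\<Union>i. A i)"
    then obtain i y where "C i x y"
      using C(2) by auto
    then have "D x (case_nat i y)"
      by (simp add: D_def)
    then show "\<exists>y. D x y"
      by blast
  next
    fix x
    assume "x \<in> {x. \<exists>y. D x y}"
    then show "x \<in> (\<Union>i. A i)"
      unfolding C(2) by (auto simp: D_def)
  qed
  ultimately show ?thesis
    by (auto simp: analytic_def)
qed

text \<open>One sequence carries a witness for every \<open>i\<close> at once, stored in the columns
  of the pairing function.\<close>

lemma analytic_INT:
  fixes A :: "nat \<Rightarrow> (nat \<Rightarrow> bool) set"
  assumes "\<And>i. analytic (A i)"
  shows "analytic (\<Inter>i. A i)"
proof -
  obtain C where C: "\<And>i. closed_rel (C i)" "\<And>i. A i = {x. \<exists>y. C i x y}"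
    using assms unfolding analytic_def by metis
  define D where "D = (\<lambda>x y. \<forall>i. C i x (\<lambda>j. y (prod_encode (i, j))))"
  have "closed_rel D"
    unfolding closed_rel_def
  proof (intro allI impI)
    fix x y
    assume "\<not> D x y"
    then obtain i where "\<not> C i x (\<lambda>j. y (prod_encode (i, j)))"
      by (auto simp: D_def)
    then obtain n where n: "\<And>x' y'. agree n x x' \<Longrightarrow> agree n (\<lambda>j. y (prod_encode (i, j))) y' \<Longrightarrow> \<not> C i x' y'"
      using C(1) unfolding closed_rel_def by metis
    \<comment> \<open>Failure in column \<open>i\<close> is decided by finitely many entries, and
      all of them sit at positions below some \<open>m\<close>.\<close>
    have "finite ((\<lambda>j. prod_encode (i, j)) ` {..<n})"
      by simp
    then obtain m where m: "\<And>j. j < n \<Longrightarrow> prod_encode (i, j) < m"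
      unfolding finite_nat_set_iff_bounded by auto
    have "\<not> D x' y'" if "agree (max m n) x x'" "agree (max m n) y y'" for x' y'
    proof -
      have "agree n x x'" "agree n (\<lambda>j. y (prod_encode (i, j))) (\<lambda>j. y' (prod_encode (i, j)))"
        using that m by (auto simp: agree_def less_max_iff_disj)
      then show ?thesis
        using n by (auto simp: D_def)
    qed
    then show "\<exists>n. \<forall>x' y'. agree n x x' \<longrightarrow> agree n y y' \<longrightarrow> \<not> D x' y'"
      by blast
  qed
  moreover have "(\<Inter>i. A i) = {x. \<exists>y. D x y}"
  proof (intro equalityI subsetI CollectI)
    fix x
    assume "x \<in> (\<Inter>i. A i)"
    then obtain Y where "\<And>i. C i x (Y i)"
      unfolding C(2) by simp metis
    then have "D x (\<lambda>k. Y (fst (prod_decode k)) (snd (prod_decode k)))"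
      by (simp add: D_def)
    then show "\<exists>y. D x y"
      by blast
  next
    fix x
    assume "x \<in> {x. \<exists>y. D x y}"
    then show "x \<in> (\<Inter>i. A i)"
      unfolding C(2) by (auto simp: D_def)
  qed
  ultimately show ?thesis
    by (auto simp: analytic_def)
qed

lemma analytic_vimage_borel:
  assumes top: "\<And>x. f x \<in> topspace X"
    and cont: "\<And>U. openin X U \<Longrightarrow> open_seq {x. f x \<in> U}"
    and S: "borel_in X S"
  shows "analytic {x. f x \<in> S}" "analytic {x. f x \<notin> S}"
proof -
  have "S \<in> sigma_sets (topspace X) {U. openin X U}"
    using S by (simp add: borel_in_def)
  then have "analytic {x. f x \<in> S} \<and> analytic {x. f x \<notin> S}"
  proof induction
    case (Basic U)
    then show ?case
      using analytic_open_seq[OF cont] analytic_Compl_open_seq[OF cont] by (simp add: Compl_eq)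
  next
    case Empty
    then show ?case
      using analytic_open_seq[of "{}"] analytic_open_seq[of UNIV] by (simp add: open_seq_def)
  next
    case (Compl S)
    then show ?case
      using top by simp
  next
    case (Union S)
    have "{x. f x \<in> (\<Union>i. S i)} = (\<Union>i. {x. f x \<in> S i})"
      "{x. f x \<notin> (\<Union>i. S i)} = (\<Inter>i. {x. f x \<notin> S i})"
      by auto
    then show ?case
      using Union.IH analytic_UN[of "\<lambda>i. {x. f x \<in> S i}"] analytic_INT[of "\<lambda>i. {x. f x \<notin> S i}"]
      by simp
  qed
  then show "analytic {x. f x \<in> S}" "analytic {x. f x \<notin> S}"
    by auto
qed

section \<open>Trees coded by binary sequences\<close>

text \<open>
  A binary sequence \<open>x\<close> codes a family of basic open boxes, the box with code \<open>(a, b)\<close> being the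
  set of pairs of sequences that begin with \<open>a\<close> and \<open>b\<close>.  The branches of \<open>seq_tree x\<close> are the \<open>y\<close>
  such that \<open>(x, y)\<close> avoids all boxes coded by \<open>x\<close> itself.  The bound on the code makes the
  nodes of length at most \<open>n\<close> depend only on the first \<open>n\<close> terms of \<open>x\<close>.
\<close>

definition box_code :: "nat \<Rightarrow> (nat \<Rightarrow> bool) \<Rightarrow> nat list \<Rightarrow> nat"
  where "box_code k x t = to_nat (map x [0..<k], take k t)"

definition seq_tree :: "(nat \<Rightarrow> bool) \<Rightarrow> nat list set"
  where "seq_tree x =
    {t. \<forall>k\<le>length t. box_code k x t < length t \<longrightarrow> \<not> x (box_code k x t)}"

definition prefix_closed :: "nat list set \<Rightarrow> bool"
  where "prefix_closed T \<longleftrightarrow> (\<forall>t\<in>T. \<forall>k. take k t \<in> T)"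

definition has_branch :: "nat list set \<Rightarrow> bool"
  where "has_branch T \<longleftrightarrow> (\<exists>y. \<forall>n. map y [0..<n] \<in> T)"

lemma prefix_closed_seq_tree: "prefix_closed (seq_tree x)"
  by (auto simp: prefix_closed_def seq_tree_def box_code_def min_absorb1)

lemma seq_tree_agree:
  assumes "agree n x x'" "length t \<le> n"
  shows "t \<in> seq_tree x \<longleftrightarrow> t \<in> seq_tree x'"
proof -
  have "box_code k x t = box_code k x' t" if "k \<le> length t" for k
    using assms that by (auto simp: box_code_def agree_def)
  moreover have "x m = x' m" if "m < length t" for m
    using assms that by (auto simp: agree_def)
  ultimately show ?thesis
    unfolding seq_tree_def by auto
qed

text \<open>A node tests only boxes bounded by its length, but along an infinite branch every box is
  tested eventually.\<close>

lemma has_branch_seq_tree: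
  "has_branch (seq_tree x) \<longleftrightarrow>
    (\<exists>y. \<forall>k. \<not> x (to_nat (map x [0..<k], map y [0..<k] :: nat list)))"
proof -
  have "(\<forall>n. map y [0..<n] \<in> seq_tree x) \<longleftrightarrow>
      (\<forall>k. \<not> x (to_nat (map x [0..<k], map y [0..<k])))" for y
  proof (intro iffI allI)
    fix k
    assume y: "\<forall>n. map y [0..<n] \<in> seq_tree x"
    let ?c = "to_nat (map x [0..<k], map y [0..<k])"
    \<comment> \<open>This prefix is long enough to contain the first \<open>k\<close> terms and to
      exceed the code \<open>?c\<close>.\<close>
    have "map y [0..<max k (Suc ?c)] \<in> seq_tree x"
      using y by blast
    moreover have "box_code k x (map y [0..<max k (Suc ?c)]) = ?c"
      by (simp add: box_code_def take_map)
    ultimately show "\<not> x ?c"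
      unfolding seq_tree_def mem_Collect_eq
      by (metis length_map length_upt diff_zero max.cobounded1 max.cobounded2 Suc_le_lessD)
  next
    fix n
    assume "\<forall>k. \<not> x (to_nat (map x [0..<k], map y [0..<k]))"
    then show "map y [0..<n] \<in> seq_tree x"
      by (auto simp: seq_tree_def box_code_def take_map)
  qed
  then show ?thesis
    by (simp add: has_branch_def)
qed

text \<open>Cantor's diagonal argument: every analytic set is coded by some sequence.\<close>

lemma not_analytic_no_branch: "\<not> analytic {x. \<not> has_branch (seq_tree x)}"
proof
  assume "analytic {x. \<not> has_branch (seq_tree x)}"
  then obtain C where C: "closed_rel C" "{x. \<not> has_branch (seq_tree x)} = {x. \<exists>y. C x y}"
    by (auto simp: analytic_def)
  \<comment> \<open>\<open>c\<close> codes every box that misses \<open>C\<close>. Pairs of lists of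
    different lengths are also included, but they are never consulted.\<close>
  define c where "c n \<longleftrightarrow> \<not> (\<exists>x y k. C x y \<and> from_nat n = (map x [0..<k], map y [0..<k]))" for n
  have "C x y \<longleftrightarrow> (\<forall>k. \<not> c (to_nat (map x [0..<k], map y [0..<k])))" for x y
  proof
    assume "C x y"
    then show "\<forall>k. \<not> c (to_nat (map x [0..<k], map y [0..<k]))"
      unfolding c_def by auto
  next
    assume *: "\<forall>k. \<not> c (to_nat (map x [0..<k], map y [0..<k]))"
    show "C x y"
    proof (rule ccontr)
      assume "\<not> C x y"
      then obtain n where n: "\<And>x' y'. agree n x x' \<Longrightarrow> agree n y y' \<Longrightarrow> \<not> C x' y'"
        using C(1) unfolding closed_rel_def by metis
      \<comment> \<open>The box of length \<open>n\<close> around \<open>(x, y)\<close> is not coded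
        by \<open>c\<close>, so it meets \<open>C\<close>.\<close>
      obtain x' y' k where k: "C x' y'" "map x [0..<n] = map x' [0..<k]" "map y [0..<n] = map y' [0..<k]"
        using *[rule_format, of n] unfolding c_def by auto
      have "k = n"
        using arg_cong[OF k(2), of length] by simp
      then show False
        using n k unfolding agree_iff_map by metis
    qed
  qed
  \<comment> \<open>The diagonal step: \<open>x\<close> is taken to be \<open>c\<close>, whose
    membership in the projection of \<open>C\<close> then contradicts itself.\<close>
  then have "(\<exists>y. C c y) \<longleftrightarrow> has_branch (seq_tree c)"
    unfolding has_branch_seq_tree by simp
  then show False
    using C(2) by blast
qed

section \<open>The space of continuous pseudo-ultrametrics\<close>

lemma UD_commute: "UD X R d e = UD X R e d"
  unfolding UD_def by (rule arg_cong[of _ _ Inf]) auto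

text \<open>The larger of a threshold for \<open>d\<close>, \<open>e\<close> and one for
  \<open>e\<close>, \<open>f\<close> is a threshold for \<open>d\<close>, \<open>f\<close>; as a
  maximum it is one of the two, so it stays in the allowed set.\<close>

lemma UD_ultra: "UD X R d f \<le> max (UD X R d e) (UD X R e f)"
proof (rule ccontr)
  define S where "S d e = {\<epsilon> \<in> ennreal ` R \<union> {\<infinity>}. \<forall>x\<in>topspace X. \<forall>y\<in>topspace X.
    ennreal (d x y) \<le> max (ennreal (e x y)) \<epsilon> \<and> ennreal (e x y) \<le> max (ennreal (d x y)) \<epsilon>}"
    for d e
  have UD: "UD X R d e = Inf (S d e)" for d e
    by (simp add: UD_def S_def)
  assume "\<not> UD X R d f \<le> max (UD X R d e) (UD X R e f)"
  then obtain a b where ab: "a \<in> S d e" "b \<in> S e f" "a < UD X R d f" "b < UD X R d f"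
    unfolding not_le max_less_iff_conj UD Inf_less_iff by blast
  have "ennreal (d x y) \<le> max (ennreal (f x y)) (max a b) \<and>
      ennreal (f x y) \<le> max (ennreal (d x y)) (max a b)"
    if "x \<in> topspace X" "y \<in> topspace X" for x y
  proof -
    have "ennreal (d x y) \<le> max (ennreal (e x y)) a" "ennreal (e x y) \<le> max (ennreal (d x y)) a"
      "ennreal (e x y) \<le> max (ennreal (f x y)) b" "ennreal (f x y) \<le> max (ennreal (e x y)) b"
      using ab(1,2) that by (auto simp: S_def)
    then show ?thesis
      by (auto simp: le_max_iff_disj intro: order_trans)
  qed
  moreover have "max a b \<in> ennreal ` R \<union> {\<infinity>}"
    using ab(1,2) by (auto simp: S_def max_def)
  ultimately have "max a b \<in> S d f"
    by (auto simp: S_def)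
  then have "UD X R d f \<le> max a b"
    unfolding UD by (rule Inf_lower)
  then show False
    using ab(3,4) by (auto simp: le_max_iff_disj)
qed

lemma UD_self:
  assumes "range_set R"
  shows "UD X R d d = 0"
proof -
  have "ennreal 0 \<in> ennreal ` R"
    using assms unfolding range_set_def by blast
  then have "UD X R d d \<le> ennreal 0"
    unfolding UD_def by (intro Inf_lower) simp
  then show ?thesis
    by simp
qed

lemma UCPM_nonneg:
  assumes "d \<in> UCPM X R" "x \<in> topspace X" "y \<in> topspace X"
  shows "0 \<le> d x y"
proof -
  have "(\<lambda>(x, y). d x y) \<in> topspace X \<times> topspace X \<rightarrow> {0..}"
    using assms(1) by (simp add: UCPM_def continuous_map_def)
  then have "(case (x, y) of (x, y) \<Rightarrow> d x y) \<in> {0..}"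
    by (rule funcset_mem) (simp add: assms(2,3))
  then show ?thesis
    by simp
qed

lemma UD_eq_0D:
  assumes "UD X R d e = 0" "d \<in> UCPM X R" "e \<in> UCPM X R"
  shows "d = e"
proof -
  have le: "d x y \<le> e x y"
    if "UD X R d e = 0" "d \<in> UCPM X R" "e \<in> UCPM X R" "x \<in> topspace X" "y \<in> topspace X"
    for d e x y
  proof (rule ccontr)
    assume "\<not> d x y \<le> e x y"
    \<comment> \<open>Nonnegativity makes \<open>d x y\<close> positive, so the strict inequality
      survives the truncation at zero by \<open>ennreal\<close>.\<close>
    moreover have "0 \<le> e x y"
      using UCPM_nonneg[OF that(3-5)] .
    ultimately have less: "ennreal (e x y) < ennreal (d x y)" and "0 < d x y"
      by (auto simp: ennreal_lessI)
    then have "UD X R d e < ennreal (d x y)"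
      using that(1) by simp
    then obtain \<epsilon> where \<epsilon>: "\<epsilon> < ennreal (d x y)"
        "\<forall>x\<in>topspace X. \<forall>y\<in>topspace X. ennreal (d x y) \<le> max (ennreal (e x y)) \<epsilon> \<and>
          ennreal (e x y) \<le> max (ennreal (d x y)) \<epsilon>"
      unfolding UD_def Inf_less_iff by (elim bexE CollectE conjE) (rule that)
    then have "ennreal (d x y) \<le> max (ennreal (e x y)) \<epsilon>"
      using that(4,5) by blast
    then show False
      using less \<epsilon>(1) by (auto simp: le_max_iff_disj)
  qed
  show ?thesis
  proof (intro ext)
    fix x y
    show "d x y = e x y"
    proof (cases "x \<in> topspace X \<and> y \<in> topspace X")
      case True
      then show ?thesis
        using le[OF assms] le[of e d] assms by (metis UD_commute antisym)
    next
      case False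
      then show ?thesis
        using assms(2,3) by (auto simp: UCPM_def zero_outside_def)
    qed
  qed
qed

text \<open>Truncating \<open>UD\<close> at 1 gives a real-valued metric with the same balls of
  radius at most 1.\<close>

lemma metrizable_space_UCPM_topology:
  assumes "range_set R"
  shows "metrizable_space (UCPM_topology X R)"
proof -
  \<comment> \<open>The truncation comes first because \<open>enn2real\<close> would send an
    infinite distance to 0.\<close>
  define D where "D d e = enn2real (min 1 (UD X R d e))" for d e
  have fin: "min 1 (UD X R d e) < top" for d e
    by (simp add: min_less_iff_disj)
  have D: "ennreal (D d e) = min 1 (UD X R d e)" for d e
    unfolding D_def using fin by simp
  have less: "D d e < r \<longleftrightarrow> UD X R d e < ennreal r" if "0 < r" "r \<le> 1" for d e r
  proof -
    have "D d e < r \<longleftrightarrow> ennreal (D d e) < ennreal r"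
      by (simp add: ennreal_less_iff D_def)
    also have "\<dots> \<longleftrightarrow> UD X R d e < ennreal r"
      using that ennreal_leI[of r 1] unfolding D min_less_iff_disj by auto
    finally show ?thesis .
  qed
  interpret U: Metric_space "UCPM X R" D
  proof
    fix d e f
    show "0 \<le> D d e"
      unfolding D_def by (rule enn2real_nonneg)
    show "D d e = D e d"
      unfolding D_def by (subst UD_commute) (rule refl)
    show "D d e = 0 \<longleftrightarrow> d = e" if "d \<in> UCPM X R" "e \<in> UCPM X R"
    proof
      assume "D d e = 0"
      then have "min 1 (UD X R d e) = 0"
        unfolding D[symmetric] by simp
      then have "UD X R d e = 0"
        by (metis min_def zero_neq_one)
      then show "d = e"
        using UD_eq_0D that by metis
    qed (simp add: D_def UD_self[OF assms])
    show "D d f \<le> D d e + D e f"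
    proof -
      have "min 1 (UD X R d f) \<le> max (min 1 (UD X R d e)) (min 1 (UD X R e f))"
        unfolding min_max_distrib2[symmetric] by (intro min.mono UD_ultra order_refl)
      then have "D d f \<le> max (D d e) (D e f)"
        unfolding D[symmetric] le_max_iff_disj by (simp add: ennreal_le_iff D_def)
      moreover have "0 \<le> D d e" "0 \<le> D e f"
        unfolding D_def by (rule enn2real_nonneg)+
      ultimately show ?thesis
        by linarith
    qed
  qed
  have "U.mtopology = UCPM_topology X R"
    unfolding topology_eq
  proof (intro allI)
    fix V
    have "(\<exists>r>0. U.mball d r \<subseteq> V) \<longleftrightarrow> (\<exists>\<epsilon>>0. {e \<in> UCPM X R. UD X R d e < \<epsilon>} \<subseteq> V)"
      if d: "d \<in> UCPM X R" for d
    proof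
      assume "\<exists>r>0. U.mball d r \<subseteq> V"
      then obtain r where r: "r > 0" "U.mball d r \<subseteq> V"
        by blast
      have "{e \<in> UCPM X R. UD X R d e < ennreal (min r 1)} \<subseteq> U.mball d r"
        using r(1) d by (auto simp: less[of "min r 1" d, symmetric])
      then show "\<exists>\<epsilon>>0. {e \<in> UCPM X R. UD X R d e < \<epsilon>} \<subseteq> V"
        using r by (intro exI[of _ "ennreal (min r 1)"]) auto
    next
      assume "\<exists>\<epsilon>>0. {e \<in> UCPM X R. UD X R d e < \<epsilon>} \<subseteq> V"
      then obtain \<epsilon> where \<epsilon>: "\<epsilon> > 0" "{e \<in> UCPM X R. UD X R d e < \<epsilon>} \<subseteq> V"
        by blast
      define r where "r = enn2real (min 1 \<epsilon>)"
      have r: "ennreal r = min 1 \<epsilon>"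
        by (simp add: r_def min_less_iff_disj)
      have "0 < r" "r \<le> 1"
        using \<epsilon>(1) ennreal_less_zero_iff[of r] ennreal_le_1[of r] unfolding r by auto
      then have "U.mball d r \<subseteq> {e \<in> UCPM X R. UD X R d e < \<epsilon>}"
        using less[OF \<open>0 < r\<close> \<open>r \<le> 1\<close>] unfolding r by auto
      then show "\<exists>r>0. U.mball d r \<subseteq> V"
        using \<open>0 < r\<close> \<epsilon>(2) by blast
    qed
    then show "openin U.mtopology V \<longleftrightarrow> openin (UCPM_topology X R) V"
      unfolding U.openin_mtopology openin_UCPM_topology by blast
  qed
  then show ?thesis
    using U.metrizable_space_mtopology by simp
qed

lemma borel_in_gdelta_in:
  assumes "gdelta_in X S"
  shows "borel_in X S"
proof -
  obtain C :: "nat \<Rightarrow> _" where C: "\<And>n. openin X (C n)" "S = \<Inter>(range C)"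
    using assms by (auto simp: gdelta_in_descending)
  have "S = topspace X - (\<Union>n. topspace X - C n)"
    using C openin_subset by blast
  also have "\<dots> \<in> sigma_sets (topspace X) {U. openin X U}"
    using C(1) by (intro sigma_sets.Compl sigma_sets.Union sigma_sets.Basic) auto
  finally show ?thesis
    by (simp add: borel_in_def)
qed

section \<open>Ultrametrics built from trees\<close>

definition common_prefix :: "nat list set \<Rightarrow> nat list \<Rightarrow> nat list \<Rightarrow> nat \<Rightarrow> bool"
  where "common_prefix T s t n \<longleftrightarrow> n \<le> length s \<and> n \<le> length t \<and>
    (n = 0 \<or> take n s = take n t \<and> take n s \<in> T)"

definition depth :: "nat list set \<Rightarrow> nat list \<Rightarrow> nat list \<Rightarrow> nat"
  where "depth T s t = Max {n. common_prefix T s t n}"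

lemma common_prefix_mono:
  assumes "prefix_closed T" "common_prefix T s t n" "k \<le> n"
  shows "common_prefix T s t k"
proof -
  have "take k s = take k (take n s)" "take k t = take k (take n t)"
    using assms(3) by (simp_all add: min_absorb1)
  then show ?thesis
    using assms unfolding common_prefix_def prefix_closed_def
    by (metis le_zero_eq order_trans)
qed

text \<open>By prefix-closedness the admissible lengths form a finite initial segment of the
  naturals, which its maximum determines.\<close>

lemma le_depth_iff:
  assumes "prefix_closed T"
  shows "k \<le> depth T s t \<longleftrightarrow> common_prefix T s t k"
proof -
  let ?N = "{n. common_prefix T s t n}"
  have fin: "finite ?N"
    by (rule finite_subset[of _ "{..length s}"]) (auto simp: common_prefix_def)
  moreover have "0 \<in> ?N"
    by (simp add: common_prefix_def)
  ultimately have "common_prefix T s t (depth T s t)"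
    unfolding depth_def using Max_in by blast
  then show ?thesis
    using common_prefix_mono[OF assms] Max_ge[OF fin] unfolding depth_def by blast
qed

lemma depth_commute: "depth T s t = depth T t s"
  unfolding depth_def common_prefix_def by (rule arg_cong[of _ _ Max]) auto

lemma depth_le_length: "prefix_closed T \<Longrightarrow> depth T s t \<le> length s"
  using le_depth_iff[of T "depth T s t" s t] by (simp add: common_prefix_def)

lemma depth_ultra:
  assumes "prefix_closed T"
  shows "min (depth T s t) (depth T t u) \<le> depth T s u"
proof -
  define k where "k = min (depth T s t) (depth T t u)"
  have "common_prefix T s t k" "common_prefix T t u k"
    unfolding le_depth_iff[OF assms, symmetric] k_def by simp_all
  then show ?thesis
    unfolding k_def[symmetric] le_depth_iff[OF assms] common_prefix_def by auto
qed

text \<open>Trees with the same nodes up to length \<open>n\<close> admit the same lengths up to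
  \<open>n\<close>. Strictness lets the failure at the next length transfer too.\<close>

lemma depth_cong:
  assumes "prefix_closed T" "prefix_closed T'"
    and eq: "\<And>t. length t \<le> n \<Longrightarrow> t \<in> T \<longleftrightarrow> t \<in> T'"
    and less: "depth T s t < n"
  shows "depth T' s t = depth T s t"
proof -
  have "common_prefix T s t k \<longleftrightarrow> common_prefix T' s t k" if "k \<le> n" for k
    using eq[of "take k s"] that by (auto simp: common_prefix_def)
  then have "k \<le> depth T s t \<longleftrightarrow> k \<le> depth T' s t" if "k \<le> n" for k
    using that assms(1,2) by (simp add: le_depth_iff)
  then show ?thesis
    using less by (metis Suc_leI le_antisym less_imp_le_nat not_less_eq_eq order_refl)
qed

text \<open>Balls around \<open>x\<close> of radius at most \<delta> coincide for both metrics;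
  \<delta> may depend on \<open>x\<close>.\<close>

lemma mtopology_eqI:
  assumes "Metric_space M d" "Metric_space M e"
    and eq: "\<And>x. x \<in> M \<Longrightarrow> \<exists>\<delta>>0. \<forall>y\<in>M. d x y < \<delta> \<or> e x y < \<delta> \<longrightarrow> d x y = e x y"
  shows "Metric_space.mtopology M d = Metric_space.mtopology M e"
proof -
  interpret d: Metric_space M d by fact
  interpret e: Metric_space M e by fact
  have "(\<exists>r>0. d.mball x r \<subseteq> U) \<longleftrightarrow> (\<exists>r>0. e.mball x r \<subseteq> U)" if "x \<in> M" for x U
  proof -
    obtain \<delta> where \<delta>: "\<delta> > 0" "\<forall>y\<in>M. d x y < \<delta> \<or> e x y < \<delta> \<longrightarrow> d x y = e x y"
      using eq[OF \<open>x \<in> M\<close>] by blast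
    have sub: "d.mball x (min r \<delta>) \<subseteq> e.mball x r" "e.mball x (min r \<delta>) \<subseteq> d.mball x r" for r
      using \<delta>(2) unfolding d.mball_def e.mball_def by auto
    show ?thesis
    proof
      assume "\<exists>r>0. d.mball x r \<subseteq> U"
      then obtain r where "r > 0" "d.mball x r \<subseteq> U"
        by blast
      then show "\<exists>r>0. e.mball x r \<subseteq> U"
        using sub(2)[of r] \<delta>(1) by (intro exI[of _ "min r \<delta>"]) auto
    next
      assume "\<exists>r>0. e.mball x r \<subseteq> U"
      then obtain r where "r > 0" "e.mball x r \<subseteq> U"
        by blast
      then show "\<exists>r>0. d.mball x r \<subseteq> U"
        using sub(1)[of r] \<delta>(1) by (intro exI[of _ "min r \<delta>"]) auto
    qed
  qed
  then show ?thesis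
    unfolding topology_eq d.openin_mtopology e.openin_mtopology by blast
qed

section \<open>The ultrametric of a tree on a space divided into pieces\<close>

locale tree_ultrametric = Metric_space M d for M :: "'a set" and d +
  fixes piece :: "'a \<Rightarrow> nat list" and r :: "nat \<Rightarrow> real"
  assumes ultra: "\<lbrakk>x \<in> M; y \<in> M; z \<in> M\<rbrakk> \<Longrightarrow> d x z \<le> max (d x y) (d y z)"
    and piece_locally_constant: "\<exists>\<delta>>0. \<forall>x\<in>M. \<forall>y\<in>M. d x y < \<delta> \<longrightarrow> piece x = piece y"
    and piece_surj: "\<exists>x\<in>M. piece x = s"
    and r_pos: "0 < r n"
    and r_Suc: "r (Suc n) < r n"
    and r_small: "0 < \<epsilon> \<Longrightarrow> \<exists>n. r n < \<epsilon>"
begin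

lemma r_mono: "m \<le> n \<Longrightarrow> r n \<le> r m"
  by (rule lift_Suc_antimono_le[of r]) (simp_all add: r_Suc less_imp_le)

lemma r_less_iff: "r m < r n \<longleftrightarrow> n < m"
proof
  show "r m < r n" if "n < m"
    using r_mono[of "Suc n" m] r_Suc[of n] that by simp
  show "n < m" if "r m < r n"
    using r_mono[of m n] that by (meson leI leD)
qed

text \<open>The cap keeps the diameter of a piece at most its distance to any other piece, since a
  depth never exceeds the length of the index.\<close>

definition tdist :: "nat list set \<Rightarrow> 'a \<Rightarrow> 'a \<Rightarrow> real"
  where "tdist T x y =
    (if x \<notin> M \<or> y \<notin> M then 0
     else if piece x = piece y then min (d x y) (r (length (piece x)))
     else r (depth T (piece x) (piece y)))"

lemma tdist_commute: "tdist T x y = tdist T y x"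
  by (simp add: tdist_def commute depth_commute)

lemma tdist_nonneg: "0 \<le> tdist T x y"
  by (simp add: tdist_def less_imp_le[OF r_pos])

lemma tdist_ultra:
  assumes T: "prefix_closed T" and M: "x \<in> M" "y \<in> M" "z \<in> M"
  shows "tdist T x z \<le> max (tdist T x y) (tdist T y z)"
proof -
  let ?s = "piece x" and ?t = "piece y" and ?u = "piece z"
  consider "?s = ?t" "?t = ?u" | "?s = ?t" "?t \<noteq> ?u" | "?s \<noteq> ?t" "?t = ?u"
    | "?s = ?u" "?s \<noteq> ?t" | "?s \<noteq> ?t" "?t \<noteq> ?u" "?s \<noteq> ?u"
    by blast
  then show ?thesis
  proof cases
    case 1
    then show ?thesis
      using ultra[OF M] M by (auto simp: tdist_def min_def max_def)
  next
    \<comment> \<open>Here \<open>y\<close> lies outside the common piece of \<open>x\<close> and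
      \<open>z\<close>, and the cap gives the bound.\<close>
    case 4
    then have "tdist T x z \<le> r (length ?s)" "tdist T x y = r (depth T ?s ?t)"
      using M by (simp_all add: tdist_def)
    then show ?thesis
      using r_mono[OF depth_le_length[OF T], of ?s ?t] by linarith
  next
    case 5
    have "r (depth T ?s ?u) \<le> max (r (depth T ?s ?t)) (r (depth T ?t ?u))"
      using depth_ultra[OF T, of ?s ?t ?u] r_mono unfolding min_le_iff_disj le_max_iff_disj by blast
    then show ?thesis
      using 5 M by (simp add: tdist_def)
  qed (use M in \<open>simp_all add: tdist_def\<close>)
qed

lemma Metric_space_tdist:
  assumes "prefix_closed T"
  shows "Metric_space M (tdist T)"
proof
  fix x y z
  show "0 \<le> tdist T x y" "tdist T x y = tdist T y x"
    by (rule tdist_nonneg tdist_commute)+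
  show "tdist T x y = 0 \<longleftrightarrow> x = y" if "x \<in> M" "y \<in> M"
  proof (cases "piece x = piece y")
    case True
    then show ?thesis
      using that r_pos[of "length (piece y)"] zero[OF that] by (auto simp: tdist_def min_def)
  next
    case False
    then show ?thesis
      using that r_pos[of "depth T (piece x) (piece y)"] by (auto simp: tdist_def)
  qed
  show "tdist T x z \<le> tdist T x y + tdist T y z" if "x \<in> M" "y \<in> M" "z \<in> M"
    using tdist_ultra[OF assms that] tdist_nonneg[of T x y] tdist_nonneg[of T y z] by linarith
qed

text \<open>Other pieces are at distance at least \<open>r (length (piece x))\<close>, and below
  that value the cap is inactive.\<close>

lemma tdist_less_length:
  assumes "prefix_closed T" "x \<in> M" "y \<in> M" "tdist T x y < r (length (piece x))"
  shows "piece x = piece y" "tdist T x y = d x y"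
proof -
  show *: "piece x = piece y"
    using assms r_mono[OF depth_le_length[OF assms(1)], of "piece x" "piece y"]
    by (auto simp: tdist_def split: if_splits)
  show "tdist T x y = d x y"
    using assms * by (auto simp: tdist_def)
qed

lemma mtopology_tdist:
  assumes "prefix_closed T"
  shows "Metric_space.mtopology M (tdist T) = mtopology"
proof (rule mtopology_eqI[OF Metric_space_tdist[OF assms] Metric_space_axioms])
  fix x
  assume x: "x \<in> M"
  obtain \<delta> where \<delta>: "\<delta> > 0" "\<forall>x\<in>M. \<forall>y\<in>M. d x y < \<delta> \<longrightarrow> piece x = piece y"
    using piece_locally_constant by blast
  let ?\<delta> = "min \<delta> (r (length (piece x)))"
  have "tdist T x y = d x y" if "y \<in> M" "tdist T x y < ?\<delta> \<or> d x y < ?\<delta>" for y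
    using that(2)
  proof
    assume "tdist T x y < ?\<delta>"
    then show ?thesis
      using tdist_less_length[OF assms x \<open>y \<in> M\<close>] by simp
  next
    assume "d x y < ?\<delta>"
    then show ?thesis
      using \<delta>(2) x \<open>y \<in> M\<close> by (auto simp: tdist_def)
  qed
  moreover have "0 < ?\<delta>"
    using \<delta>(1) r_pos by simp
  ultimately show "\<exists>\<delta>>0. \<forall>y\<in>M. tdist T x y < \<delta> \<or> d x y < \<delta> \<longrightarrow> tdist T x y = d x y"
    by blast
qed

text \<open>Points chosen in the pieces along a branch form a Cauchy sequence. A limit would have a
  single piece containing the whole tail, but the indices have different lengths.\<close>

lemma not_mcomplete_tdist:
  assumes T: "prefix_closed T" and "has_branch T"
  shows "\<not> Metric_space.mcomplete M (tdist T)"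
proof
  interpret t: Metric_space M "tdist T"
    by (rule Metric_space_tdist[OF T])
  assume complete: t.mcomplete
  obtain y where y: "\<And>n. map y [0..<n] \<in> T"
    using \<open>has_branch T\<close> by (auto simp: has_branch_def)
  obtain \<sigma> where \<sigma>: "\<And>n. \<sigma> n \<in> M" "\<And>n. piece (\<sigma> n) = map y [0..<n]"
    using that[of "\<lambda>n. SOME x. x \<in> M \<and> piece x = map y [0..<n]"]
      someI_ex[OF piece_surj[unfolded Bex_def]] by blast
  have le: "tdist T (\<sigma> m) (\<sigma> n) \<le> r k" if "k \<le> m" "k \<le> n" for m n k
  proof (cases "m = n")
    case True
    then show ?thesis
      using \<sigma>(1) r_pos[of k] by (simp add: less_imp_le)
  next
    case False
    then have "piece (\<sigma> m) \<noteq> piece (\<sigma> n)"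
      unfolding \<sigma>(2) by (metis length_map length_upt diff_zero)
    moreover have "common_prefix T (piece (\<sigma> m)) (piece (\<sigma> n)) k"
      unfolding \<sigma>(2) common_prefix_def using that y by (simp add: take_map)
    ultimately show ?thesis
      using \<sigma>(1) r_mono by (simp add: tdist_def le_depth_iff[OF T])
  qed
  have "t.MCauchy \<sigma>"
    unfolding t.MCauchy_def
  proof (intro conjI allI impI)
    fix \<epsilon> :: real
    assume "0 < \<epsilon>"
    then obtain k where "r k < \<epsilon>"
      using r_small by blast
    then show "\<exists>N. \<forall>n n'. N \<le> n \<longrightarrow> N \<le> n' \<longrightarrow> tdist T (\<sigma> n) (\<sigma> n') < \<epsilon>"
      using le by (meson le_less_trans)
  qed (use \<sigma>(1) in auto)
  then obtain x where x: "limitin t.mtopology \<sigma> x sequentially"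
    using complete by (auto simp: t.mcomplete_def)
  then have "x \<in> M" "\<forall>\<^sub>F n in sequentially. \<sigma> n \<in> M \<and> tdist T (\<sigma> n) x < r (length (piece x))"
    using r_pos unfolding t.limitin_metric by blast+
  then obtain N where "\<And>n. N \<le> n \<Longrightarrow> tdist T x (\<sigma> n) < r (length (piece x))"
    unfolding eventually_sequentially by (metis tdist_commute)
  then have "piece x = map y [0..<n]" if "N \<le> n" for n
    using tdist_less_length(1)[OF T \<open>x \<in> M\<close> \<sigma>(1)] \<sigma>(2) that by metis
  from this[of N] this[of "Suc N"] show False
    by (metis Suc_n_not_le_n diff_zero length_map length_upt le_SucI order_refl)
qed

text \<open>A Cauchy sequence that settles in one piece is eventually Cauchy for \<open>d\<close>.
  One that keeps changing pieces has indices whose prefixes stabilise to a branch of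
  \<open>T\<close>.\<close>

lemma mcomplete_tdist:
  assumes T: "prefix_closed T" and "\<not> has_branch T" and complete: mcomplete
  shows "Metric_space.mcomplete M (tdist T)"
proof -
  interpret t: Metric_space M "tdist T"
    by (rule Metric_space_tdist[OF T])
  have "\<exists>x. limitin t.mtopology \<sigma> x sequentially" if Cauchy: "t.MCauchy \<sigma>" for \<sigma>
  proof (cases "\<exists>K. \<forall>m\<ge>K. piece (\<sigma> m) = piece (\<sigma> K)")
    case True
    then obtain K where K: "\<And>m. m \<ge> K \<Longrightarrow> piece (\<sigma> m) = piece (\<sigma> K)"
      by blast
    have \<sigma>: "\<sigma> n \<in> M" for n
      using Cauchy by (auto simp: t.MCauchy_def)
    have "MCauchy (\<lambda>n. \<sigma> (n + K))"
      unfolding MCauchy_def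
    proof (intro conjI allI impI)
      fix \<epsilon> :: real
      assume "0 < \<epsilon>"
      then have "0 < min \<epsilon> (r (length (piece (\<sigma> K))))"
        using r_pos by simp
      then obtain N where N: "\<And>n n'. N \<le> n \<Longrightarrow> N \<le> n' \<Longrightarrow>
          tdist T (\<sigma> n) (\<sigma> n') < min \<epsilon> (r (length (piece (\<sigma> K))))"
        using Cauchy unfolding t.MCauchy_def by meson
      have "d (\<sigma> (n + K)) (\<sigma> (n' + K)) < \<epsilon>" if "N \<le> n" "N \<le> n'" for n n'
        using N[of "n + K" "n' + K"] tdist_less_length(2)[OF T \<sigma> \<sigma>, of "n + K" "n' + K"]
          K[of "n + K"] that by simp
      then show "\<exists>N. \<forall>n n'. N \<le> n \<longrightarrow> N \<le> n' \<longrightarrow> d (\<sigma> (n + K)) (\<sigma> (n' + K)) < \<epsilon>"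
        by blast
    qed (use \<sigma> in auto)
    then obtain x where "limitin mtopology (\<lambda>n. \<sigma> (n + K)) x sequentially"
      using complete unfolding mcomplete_def by blast
    then show ?thesis
      unfolding mtopology_tdist[OF T] by (blast intro: limitin_sequentially_offset_rev)
  next
    case False
    have \<sigma>: "\<sigma> n \<in> M" for n
      using Cauchy by (auto simp: t.MCauchy_def)
    have "\<exists>K. \<forall>m\<ge>K. \<forall>n\<ge>K. tdist T (\<sigma> m) (\<sigma> n) < r k" for k
      using Cauchy r_pos unfolding t.MCauchy_def by meson
    then obtain K where K: "\<And>k m n. K k \<le> m \<Longrightarrow> K k \<le> n \<Longrightarrow> tdist T (\<sigma> m) (\<sigma> n) < r k"
      by metis
    have common: "common_prefix T (piece (\<sigma> m)) (piece (\<sigma> n)) k"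
      if "K k \<le> m" "K k \<le> n" "piece (\<sigma> m) \<noteq> piece (\<sigma> n)" for k m n
      using K[OF that(1,2)] that(3) \<sigma>
      by (simp add: tdist_def r_less_iff le_depth_iff[OF T, symmetric])
    \<comment> \<open>\<open>u k\<close> is the stable prefix of length \<open>k\<close> of the
      indices; that it is long enough and lies in \<open>T\<close> is shown next.\<close>
    define u where "u k = take k (piece (\<sigma> (K k)))" for k
    have u: "take k (piece (\<sigma> m)) = u k" if "K k \<le> m" for k m
      using common[of k m "K k"] that unfolding u_def common_prefix_def
      by (cases "piece (\<sigma> m) = piece (\<sigma> (K k))") auto
    have u_T: "u k \<in> T \<and> length (u k) = k" if "0 < k" for k
    proof -
      \<comment> \<open>A later change of piece is needed: two points in the same piece give no
        information about \<open>T\<close>.\<close>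
      obtain m where "m \<ge> K k" "piece (\<sigma> m) \<noteq> piece (\<sigma> (K k))"
        using False by blast
      then have "common_prefix T (piece (\<sigma> m)) (piece (\<sigma> (K k))) k"
        by (intro common) auto
      then show ?thesis
        using that unfolding u_def common_prefix_def by auto
    qed
    have take_u: "take j (u k) = u j" if "j \<le> k" for j k
    proof -
      let ?m = "max (K j) (K k)"
      have "take j (u k) = take j (take k (piece (\<sigma> ?m)))"
        using u[of k ?m] by simp
      also have "\<dots> = u j"
        using u[of j ?m] that by (simp add: min_absorb1)
      finally show ?thesis .
    qed
    define y where "y j = u (Suc j) ! j" for j
    have "map y [0..<k] = u k" if "0 < k" for k
    proof (rule nth_equalityI)
      fix j
      assume "j < length (map y [0..<k])"
      then show "map y [0..<k] ! j = u k ! j"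
        using take_u[of "Suc j" k] by (auto simp: y_def) (metis lessI nth_take)
    qed (use u_T[OF that] in simp)
    then have "map y [0..<k] \<in> T" if "0 < k" for k
      using u_T that by simp
    \<comment> \<open>Length 0 tells nothing about membership in \<open>T\<close>, so the empty node
      comes from \<open>u 1\<close> by prefix-closedness.\<close>
    moreover have "[] \<in> T"
      using u_T[of 1] T by (metis prefix_closed_def take0 zero_less_one)
    ultimately have "has_branch T"
      unfolding has_branch_def by (metis gr0I list.simps(8) upt_0)
    then show ?thesis
      using \<open>\<not> has_branch T\<close> by contradiction
  qed
  then show ?thesis
    unfolding t.mcomplete_def by blast
qed

text \<open>Inside a piece the tree plays no part. Between pieces, a depth below \<open>n\<close> is
  the same for both trees, and any other depth gives a value at most \<open>r n\<close>.\<close>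

lemma tdist_approx:
  assumes "prefix_closed T" "prefix_closed T'"
    and "\<And>t. length t \<le> n \<Longrightarrow> t \<in> T \<longleftrightarrow> t \<in> T'"
  shows "tdist T x y \<le> max (tdist T' x y) (r n)"
proof (cases "depth T (piece x) (piece y) < n")
  case True
  then show ?thesis
    using depth_cong[OF assms] by (simp add: tdist_def)
next
  case False
  then have "r (depth T (piece x) (piece y)) \<le> r n"
    by (intro r_mono) simp
  then show ?thesis
    by (auto simp: tdist_def le_max_iff_disj)
qed

lemma UD_tdist:
  assumes "prefix_closed T" "prefix_closed T'"
    and "\<And>t. length t \<le> n \<Longrightarrow> t \<in> T \<longleftrightarrow> t \<in> T'"
    and "r n \<in> R"
  shows "UD X R (tdist T) (tdist T') \<le> ennreal (r n)"
proof -
  have "ennreal (tdist T x y) \<le> max (ennreal (tdist T' x y)) (ennreal (r n))"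
    "ennreal (tdist T' x y) \<le> max (ennreal (tdist T x y)) (ennreal (r n))" for x y
    using tdist_approx[OF assms(1-3), where x = x and y = y]
      tdist_approx[OF assms(2,1) assms(3)[symmetric], where x = x and y = y]
    by (auto simp: le_max_iff_disj intro: ennreal_leI)
  then show ?thesis
    unfolding UD_def using \<open>r n \<in> R\<close> by (intro Inf_lower) blast
qed

text \<open>Values stay in \<open>R\<close> because \<open>min\<close> returns one of its
  arguments.\<close>

lemma tdist_in_UMet:
  assumes "prefix_closed T" "range r \<subseteq> R" "\<And>x y. x \<in> M \<Longrightarrow> y \<in> M \<Longrightarrow> d x y \<in> R"
  shows "tdist T \<in> UMet mtopology R"
  using assms Metric_space_tdist[OF assms(1)] tdist_ultra[OF assms(1)] mtopology_tdist[OF assms(1)]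
  by (auto simp: UMet_def ultrametric_on_def zero_outside_def tdist_def min_def)

lemma tdist_in_UComp_iff:
  assumes "prefix_closed T" "range r \<subseteq> R" "\<And>x y. x \<in> M \<Longrightarrow> y \<in> M \<Longrightarrow> d x y \<in> R" mcomplete
  shows "tdist T \<in> UComp mtopology R \<longleftrightarrow> \<not> has_branch T"
  using tdist_in_UMet[OF assms(1-3)] not_mcomplete_tdist[OF assms(1)] mcomplete_tdist[OF assms(1) _ assms(4)]
  by (auto simp: UComp_def)

text \<open>The map from codes to tree ultrametrics is continuous and pulls \<open>UComp\<close>
  back to the codes of trees without a branch, which do not form an analytic set.\<close>

lemma not_borel_in_UComp:
  assumes R: "range r \<subseteq> R" "\<And>x y. x \<in> M \<Longrightarrow> y \<in> M \<Longrightarrow> d x y \<in> R" and complete: mcomplete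
  shows "\<not> borel_in (UCPM_topology mtopology R) (UComp mtopology R)"
proof
  define f where "f x = tdist (seq_tree x)" for x
  assume "borel_in (UCPM_topology mtopology R) (UComp mtopology R)"
  then have "analytic {x. f x \<in> UComp mtopology R}"
  proof (rule analytic_vimage_borel(1)[rotated 2])
    have "f x \<in> UMet mtopology R" for x
      unfolding f_def using R by (intro tdist_in_UMet prefix_closed_seq_tree)
    then show top: "f x \<in> topspace (UCPM_topology mtopology R)" for x
      using UMet_subset_UCPM unfolding topspace_UCPM_topology by blast
    show "open_seq {x. f x \<in> U}" if U: "openin (UCPM_topology mtopology R) U" for U
      unfolding open_seq_def
    proof
      fix x
      assume "x \<in> {x. f x \<in> U}"
      then obtain \<epsilon> where \<epsilon>: "\<epsilon> > 0" "{e \<in> UCPM mtopology R. UD mtopology R (f x) e < \<epsilon>} \<subseteq> U"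
        using U unfolding openin_UCPM_topology by blast
      \<comment> \<open>\<epsilon> may be infinite, whereas \<open>r_small\<close> needs a real
        bound.\<close>
      obtain \<delta> where \<delta>: "0 < \<delta>" "ennreal \<delta> < \<epsilon>"
        using ennreal_rat_dense[OF \<epsilon>(1)] by (metis ennreal_less_zero_iff)
      obtain n where n: "r n < \<delta>"
        using r_small[OF \<delta>(1)] by blast
      have "f x' \<in> U" if "agree n x x'" for x'
      proof -
        have "UD mtopology R (f x) (f x') \<le> ennreal (r n)"
          unfolding f_def using R(1) seq_tree_agree[OF that]
          by (intro UD_tdist prefix_closed_seq_tree) auto
        also have "\<dots> \<le> ennreal \<delta>"
          using n by (simp add: ennreal_leI)
        also have "\<dots> < \<epsilon>"
          by fact
        finally show ?thesis
          using \<epsilon>(2) top[of x'] unfolding topspace_UCPM_topology by blast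
      qed
      then show "\<exists>n. \<forall>x'. agree n x x' \<longrightarrow> x' \<in> {x. f x \<in> U}"
        by blast
    qed
  qed
  moreover have "f x \<in> UComp mtopology R \<longleftrightarrow> \<not> has_branch (seq_tree x)" for x
    unfolding f_def using R complete by (intro tdist_in_UComp_iff prefix_closed_seq_tree)
  ultimately show False
    using not_analytic_no_branch by simp
qed

end

section \<open>Non-separable spaces\<close>

text \<open>The union of finite nets of radii \<open>1 / (n + 1)\<close> is countable and
  dense.\<close>

lemma (in Metric_space) separable_space_mtotally_bounded:
  assumes "mtotally_bounded M"
  shows "separable_space mtopology"
proof -
  have "\<exists>K. finite K \<and> K \<subseteq> M \<and> M \<subseteq> (\<Union>x\<in>K. mball x (inverse (real (Suc n))))" for n
    using assms unfolding mtotally_bounded_def by (simp del: of_nat_Suc)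
  then obtain K where K: "\<And>n. finite (K n)" "\<And>n. K n \<subseteq> M"
      "\<And>n. M \<subseteq> (\<Union>x\<in>K n. mball x (inverse (real (Suc n))))"
    by metis
  have "\<exists>y\<in>\<Union>(range K). y \<in> mball x \<epsilon>" if "x \<in> M" "0 < \<epsilon>" for x \<epsilon>
  proof -
    obtain n where n: "inverse (real (Suc n)) < \<epsilon>"
      using reals_Archimedean[OF \<open>0 < \<epsilon>\<close>] by blast
    obtain y where "y \<in> K n" "x \<in> mball y (inverse (real (Suc n)))"
      using K(3)[of n] \<open>x \<in> M\<close> by blast
    then show ?thesis
      using n by (intro bexI[of _ y]) (auto simp: commute)
  qed
  then have "mtopology closure_of \<Union>(range K) = topspace mtopology"
    using K(2) unfolding metric_closure_of by auto
  then show ?thesis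
    unfolding separable_space_def using K(1,2)
    by (intro exI[of _ "\<Union>(range K)"]) (auto simp: countable_finite)
qed

text \<open>If only finitely many balls were distinct, one centre for each would give a finite
  net.\<close>

lemma (in Metric_space) infinite_mballs:
  assumes "\<not> mtotally_bounded M"
  obtains \<epsilon> where "0 < \<epsilon>" "infinite ((\<lambda>x. mball x \<epsilon>) ` M)"
proof -
  obtain \<epsilon> where \<epsilon>: "0 < \<epsilon>" "\<And>K. finite K \<Longrightarrow> K \<subseteq> M \<Longrightarrow> \<not> M \<subseteq> (\<Union>x\<in>K. mball x \<epsilon>)"
    using assms unfolding mtotally_bounded_def by meson
  have "infinite ((\<lambda>x. mball x \<epsilon>) ` M)"
  proof
    assume "finite ((\<lambda>x. mball x \<epsilon>) ` M)"
    then obtain K where K: "finite K" "K \<subseteq> M" "(\<lambda>x. mball x \<epsilon>) ` M = (\<lambda>x. mball x \<epsilon>) ` K"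
      using finite_subset_image[OF _ subset_refl, of "\<lambda>x. mball x \<epsilon>" M] by metis
    have "M \<subseteq> \<Union>((\<lambda>x. mball x \<epsilon>) ` M)"
      using \<epsilon>(1) by auto
    then show False
      using \<epsilon>(2)[OF K(1,2)] unfolding K(3) by blast
  qed
  then show thesis
    using that \<epsilon>(1) by blast
qed

lemma infinite_surj_countable:
  assumes "infinite A"
  obtains g :: "'b \<Rightarrow> 'c::countable" where "g ` A = UNIV"
proof -
  obtain h :: "nat \<Rightarrow> 'b" where h: "inj h" "range h \<subseteq> A"
    using infinite_countable_subset[OF assms] by blast
  have "c \<in> (from_nat \<circ> inv h) ` A" for c :: 'c
  proof
    show "c = (from_nat \<circ> inv h) (h (to_nat c))" "h (to_nat c) \<in> A"
      using h by auto
  qed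
  then show thesis
    by (intro that[of "from_nat \<circ> inv h"]) blast
qed

lemma characteristic_sequence:
  assumes "range_set R" "characteristic R"
  obtains r :: "nat \<Rightarrow> real" where "range r \<subseteq> R" "\<And>n. 0 < r n" "\<And>n. r (Suc n) < r n"
    "\<And>\<epsilon>. 0 < \<epsilon> \<Longrightarrow> \<exists>n. r n < \<epsilon>"
proof -
  have ex: "\<exists>s. (s \<in> R \<and> 0 < s \<and> s < inverse (real (Suc n))) \<and> s < t" if "0 < t" for t n
  proof -
    \<comment> \<open>Halving turns the weak inequality in \<open>characteristic\<close> into two
      strict ones.\<close>
    have "0 < min t (inverse (real (Suc n))) / 2"
      using that by simp
    then obtain s where "s \<in> R - {0}" "s \<le> min t (inverse (real (Suc n))) / 2"
      using assms(2) unfolding characteristic_def by blast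
    moreover have "0 \<le> s"
      using \<open>s \<in> R - {0}\<close> assms(1) by (auto simp: range_set_def)
    ultimately show ?thesis
      using that by (intro exI[of _ s]) (auto simp del: of_nat_Suc)
  qed
  obtain r where r: "\<And>n. r n \<in> R \<and> 0 < r n \<and> r n < inverse (real (Suc n))"
      "\<And>n. r (Suc n) < r n"
    using dependent_nat_choice[of "\<lambda>n s. s \<in> R \<and> 0 < s \<and> s < inverse (real (Suc n))"
        "\<lambda>n t s. s < t"] ex zero_less_one by metis
  show thesis
  proof (rule that)
    show "\<exists>n. r n < \<epsilon>" if "0 < \<epsilon>" for \<epsilon>
      using reals_Archimedean[OF that] r(1) by (meson less_trans)
  qed (use r in auto)
qed

theorem corollary3p17:
  fixes Y :: "'a topology" and R :: "real set"
  assumes "range_set R"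
    and "characteristic R"
    and "ultrametrizable_space Y"
    and "UComp Y R \<noteq> {}"
  shows "(borel_in (UCPM_topology Y R) (UComp Y R) \<longrightarrow> separable_space Y) \<and>
    (completely_metrizable_space (subtopology (UCPM_topology Y R) (UComp Y R)) \<longrightarrow>
      separable_space Y)"
proof -
  obtain d where d: "d \<in> UComp Y R"
    using assms(4) by blast
  then interpret Metric_space "topspace Y" d
    by (simp add: UComp_def UMet_def ultrametric_on_def)
  have top: "mtopology = Y" and complete: mcomplete
    and ultra: "\<And>x y z. \<lbrakk>x \<in> topspace Y; y \<in> topspace Y; z \<in> topspace Y\<rbrakk> \<Longrightarrow>
      d x z \<le> max (d x y) (d y z)"
    and dR: "\<And>x y. x \<in> topspace Y \<Longrightarrow> y \<in> topspace Y \<Longrightarrow> d x y \<in> R"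
    using d by (auto simp: UComp_def UMet_def ultrametric_on_def)
  obtain r where r: "range r \<subseteq> R" "\<And>n. 0 < r n" "\<And>n. r (Suc n) < r n"
    "\<And>\<epsilon>. 0 < \<epsilon> \<Longrightarrow> \<exists>n. r n < \<epsilon>"
    by (rule characteristic_sequence[OF assms(1,2)]) blast
  have not_borel: "\<not> borel_in (UCPM_topology Y R) (UComp Y R)" if "\<not> separable_space Y"
  proof -
    have "\<not> mtotally_bounded (topspace Y)"
      using that separable_space_mtotally_bounded top by auto
    then obtain \<epsilon> where \<epsilon>: "0 < \<epsilon>" "infinite ((\<lambda>x. mball x \<epsilon>) ` topspace Y)"
      using infinite_mballs by blast
    \<comment> \<open>Pieces are unions of \<epsilon>-balls, grouped so that every finite sequence
      is the index of some piece.\<close>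
    obtain g :: "'a set \<Rightarrow> nat list" where g: "g ` (\<lambda>x. mball x \<epsilon>) ` topspace Y = UNIV"
      by (rule infinite_surj_countable[OF \<epsilon>(2)])
    \<comment> \<open>In an ultrametric every point of a ball is a centre of it, so the index is
      constant at scale \<epsilon>.\<close>
    have ball_eq: "mball x \<epsilon> = mball y \<epsilon>"
      if "x \<in> topspace Y" "y \<in> topspace Y" "d x y < \<epsilon>" for x y
      using that ultra[of x y] ultra[of y x] commute[of x y]
      by (auto simp: in_mball) (meson le_less_trans max_less_iff_conj)+
    interpret tree_ultrametric "topspace Y" d "\<lambda>x. g (mball x \<epsilon>)" r
    proof
      show "\<exists>\<delta>>0. \<forall>x\<in>topspace Y. \<forall>y\<in>topspace Y. d x y < \<delta> \<longrightarrow> g (mball x \<epsilon>) = g (mball y \<epsilon>)"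
        using \<epsilon>(1) ball_eq by metis
      show "\<exists>x\<in>topspace Y. g (mball x \<epsilon>) = s" for s
        using g by (metis (no_types, lifting) UNIV_I imageE)
    qed (use ultra r in auto)
    show ?thesis
      using not_borel_in_UComp[of R] r(1) dR complete unfolding top by blast
  qed
  moreover have "borel_in (UCPM_topology Y R) (UComp Y R)"
    if "completely_metrizable_space (subtopology (UCPM_topology Y R) (UComp Y R))"
  proof (rule borel_in_gdelta_in[OF completely_metrizable_space_imp_gdelta_in])
    show "metrizable_space (UCPM_topology Y R)"
      by (rule metrizable_space_UCPM_topology[OF assms(1)])
    show "UComp Y R \<subseteq> topspace (UCPM_topology Y R)"
      using UComp_subset_UMet UMet_subset_UCPM unfolding topspace_UCPM_topology by blast
  qed fact
  ultimately show ?thesis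
    by blast
qed

end
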